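(* $z_3=2/3$; for every integer $r\ge 2$, $z_{r+1,r}=\frac{r}{r+1}$; and $z_6=1/2$.
   Context: $K_n^r$ denotes the complete $r$-uniform hypergraph on $n$ vertices. Given an edge-coloring $c$ (an arbitrary assignment of colors to edges) of $K_n^r$, let $z(n,r,c,s)$ be the fraction of the $n$ vertices that are incident with at least one edge of color $s$, and let $z(n,r,c)$ be the maximum of $z(n,r,c,s)$ over all colors $s$ appearing in $c$. Let $z_k(n,r)$ be the minimum of $z(n,r,c)$ over all edge-colorings $c$ of $K_n^r$ that use at most $k$ colors, let $z_{k,r}=\inf_{n\ge r} z_k(n,r)$, and write $z_k=z_{k,2}$. *)

theory Defs
  imports Complex_Main "HOL-Library.Ramsey"
begin

definition complete_edges :: "nat \<Rightarrow> nat \<Rightarrow> nat set set" where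
  "complete_edges n r = nsets {..<n} r"

text \<open>
  The vertex set of the complete hypergraph is \<open>{..<n}\<close>. An edge-colouring is a function from vertex sets to colours, drawn from the infinite palette
  \<open>nat\<close>. Only its values on edges are ever used, so the colours appearing in it are the
  image of the edge set, and a colouring uses at most \<open>k\<close> colours if this image has at most \<open>k\<close>
  elements.
\<close>

definition colors_of :: "nat \<Rightarrow> nat \<Rightarrow> (nat set \<Rightarrow> nat) \<Rightarrow> nat set" where
  "colors_of n r c = c ` complete_edges n r"

definition z_color :: "nat \<Rightarrow> nat \<Rightarrow> (nat set \<Rightarrow> nat) \<Rightarrow> nat \<Rightarrow> real" where
  "z_color n r c s =
     real (card {v \<in> {..<n}. \<exists>e \<in> complete_edges n r. v \<in> e \<and> c e = s}) / real n"

definition z_coloring :: "nat \<Rightarrow> nat \<Rightarrow> (nat set \<Rightarrow> nat) \<Rightarrow> real" where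
  "z_coloring n r c = Max (z_color n r c ` colors_of n r c)"

definition z_min :: "nat \<Rightarrow> nat \<Rightarrow> nat \<Rightarrow> real" where
  "z_min k n r = Min (z_coloring n r ` {c. card (colors_of n r c) \<le> k})"

definition z_inf :: "nat \<Rightarrow> nat \<Rightarrow> real" where
  "z_inf k r = (INF n\<in>{r..}. z_min k n r)"

abbreviation z_graph :: "nat \<Rightarrow> real" where
  "z_graph k \<equiv> z_inf k 2"

text \<open>
  The sets under \<open>Max\<close> and \<open>Min\<close> are finite and nonempty in the relevant range
  (\<open>n \<ge> r\<close>, \<open>k \<ge> 1\<close>), so both are genuine extrema.
\<close>

lemma finite_complete_edges: "finite (complete_edges n r)"
  by (simp add: complete_edges_def finite_imp_finite_nsets)

lemma colors_of_finite_nonempty: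
  assumes "r \<le> n"
  shows "finite (colors_of n r c)" "colors_of n r c \<noteq> {}"
proof -
  show "finite (colors_of n r c)"
    by (simp add: colors_of_def finite_complete_edges)
  have "{..<r} \<in> complete_edges n r"
    using assms by (auto simp: complete_edges_def nsets_def)
  then show "colors_of n r c \<noteq> {}"
    by (auto simp: colors_of_def)
qed

lemma z_coloring_values_finite_nonempty:
  assumes "r \<le> n" "1 \<le> k"
  shows "finite (z_coloring n r ` {c. card (colors_of n r c) \<le> k})"
    and "z_coloring n r ` {c. card (colors_of n r c) \<le> k} \<noteq> {}"
proof -
  have "z_coloring n r c \<in> (\<lambda>i. real i / real n) ` {..n}" for c
  proof -
    have "z_coloring n r c \<in> z_color n r c ` colors_of n r c"
      unfolding z_coloring_def
      using colors_of_finite_nonempty[OF assms(1)] by (intro Max_in) auto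
    moreover have "z_color n r c s \<in> (\<lambda>i. real i / real n) ` {..n}" for s
    proof -
      have "card {v \<in> {..<n}. \<exists>e \<in> complete_edges n r. v \<in> e \<and> c e = s} \<le> card {..<n}"
        by (intro card_mono) auto
      then show ?thesis
        unfolding z_color_def by (intro imageI) simp
    qed
    ultimately show ?thesis by auto
  qed
  then have "z_coloring n r ` {c. card (colors_of n r c) \<le> k} \<subseteq> (\<lambda>i. real i / real n) ` {..n}"
    by blast
  then show "finite (z_coloring n r ` {c. card (colors_of n r c) \<le> k})"
    using finite_subset by blast
  have "colors_of n r (\<lambda>_. 0) \<subseteq> {0}"
    by (auto simp: colors_of_def)
  then have "card (colors_of n r (\<lambda>_. 0)) \<le> card {0::nat}"
    by (intro card_mono) auto
  then have "(\<lambda>_. 0) \<in> {c. card (colors_of n r c) \<le> k}"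
    using assms(2) by simp
  then show "z_coloring n r ` {c. card (colors_of n r c) \<le> k} \<noteq> {}"
    by blast
qed

end

theory Submission
  imports Defs
begin

text \<open>
  Call the set of vertices incident with an edge of colour \<open>s\<close> the span of \<open>s\<close>. All that
  matters about a colouring is that every set of at most \<open>r\<close> vertices lies in a single span
  (\<open>span_covers\<close>). The problem is thus to cover all \<open>r\<close>-sets by \<open>k\<close> sets that are as small
  as possible.

  All three upper bounds come from giving different colours to all edges of a small \<open>K\<^sub>n\<^sup>r\<close>: each
  span is then one edge, so \<open>n choose r\<close> colours suffice for the ratio \<open>r / n\<close>. Taking
  \<open>n = r + 1\<close> gives \<open>r / (r + 1)\<close>, and \<open>K\<^sub>4\<close> with its six edges gives \<open>1 / 2\<close>.

  The lower bounds rest on double counting (\<open>z_coloring_ge_average\<close>): if every vertex lies in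
  at least \<open>d\<close> members of a family of at most \<open>k\<close> spans, then one of these spans has at least the proportion \<open>d / k\<close>
  of the vertices.

  For \<open>k = r + 1\<close>, suppose that no span contains all vertices. There must be exactly \<open>r + 1\<close>
  colours, since otherwise one missed vertex for each span would give a set of at most \<open>r\<close>
  vertices contained in no span. If some vertex were missed by two
  spans, that vertex together with one missed vertex for each of the other \<open>r - 1\<close> spans would
  again give such a set. So every vertex is missed by at most one
  span, and counting applies with \<open>d = r\<close>.

  For \<open>r = 2\<close> and \<open>k = 6\<close>, any two vertices lie in a common span. If every vertex lies in at
  least three spans, counting over all of them gives \<open>3 / 6\<close>. Otherwise some vertex lies in at
  most two spans; these already cover all vertices, and counting over them gives \<open>1 / 2\<close>.
\<close>

definition color_span :: "nat \<Rightarrow> nat \<Rightarrow> (nat set \<Rightarrow> nat) \<Rightarrow> nat \<Rightarrow> nat set" where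
  "color_span n r c s = {v \<in> {..<n}. \<exists>e \<in> complete_edges n r. v \<in> e \<and> c e = s}"

lemma z_color_eq: "z_color n r c s = real (card (color_span n r c s)) / real n"
  by (simp add: z_color_def color_span_def)

lemma span_covers:
  assumes "r \<le> n" "W \<subseteq> {..<n}" "card W \<le> r"
  obtains s where "s \<in> colors_of n r c" "W \<subseteq> color_span n r c s"
proof -
  obtain e where e: "W \<subseteq> e" "e \<subseteq> {..<n}" "card e = r"
    using exists_subset_between[of W r "{..<n}"] assms by auto
  then have "e \<in> complete_edges n r"
    using finite_subset[OF e(2)] by (simp add: complete_edges_def nsets_def)
  with e show ?thesis
    by (intro that[of "c e"]) (auto simp: colors_of_def color_span_def)
qed

text \<open>
  Incidences between vertices and spans are counted in two ways. The set \<open>S\<close> is arbitrary so that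
  the bound applies to all colours, to a single colour whose span is everything, and to two
  colours whose spans together cover everything.
\<close>

lemma z_coloring_ge_average:
  assumes "r \<le> n" "0 < n" and S: "S \<subseteq> colors_of n r c" "S \<noteq> {}" "card S \<le> k"
    and deg: "\<And>v. v < n \<Longrightarrow> d \<le> card {s \<in> S. v \<in> color_span n r c s}"
  shows "real d / real k \<le> z_coloring n r c"
proof -
  let ?M = "z_coloring n r c"
  note C = colors_of_finite_nonempty[OF assms(1), of c]
  have "finite S"
    using S(1) C(1) finite_subset by blast
  have span_le: "real (card (color_span n r c s)) \<le> ?M * real n" if "s \<in> S" for s
  proof -
    have "z_color n r c s \<le> ?M"
      unfolding z_coloring_def using that S C by (intro Max_ge) auto
    then show ?thesis
      using assms(2) by (simp add: z_color_eq pos_divide_le_eq)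
  qed
  have "0 \<le> ?M * real n"
    using S(2) span_le of_nat_0_le_iff order_trans by blast
  have "d * n \<le> (\<Sum>v<n. card {s \<in> S. v \<in> color_span n r c s})"
    using sum_bounded_below[of "{..<n}" d "\<lambda>v. card {s \<in> S. v \<in> color_span n r c s}"] deg
    by (simp add: mult.commute)
  also have "\<dots> = (\<Sum>s\<in>S. card {v \<in> {..<n}. v \<in> color_span n r c s})"
    using \<open>finite S\<close> by (intro sum_multicount_gen) auto
  also have "\<dots> = (\<Sum>s\<in>S. card (color_span n r c s))"
    by (intro sum.cong arg_cong[where f = card]) (auto simp: color_span_def)
  finally have "real d * real n \<le> (\<Sum>s\<in>S. real (card (color_span n r c s)))"
    by (metis of_nat_le_iff of_nat_mult of_nat_sum)
  also have "\<dots> \<le> real (card S) * (?M * real n)"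
    by (intro sum_bounded_above span_le)
  also have "\<dots> \<le> real k * (?M * real n)"
    using S(3) \<open>0 \<le> ?M * real n\<close> by (intro mult_right_mono) auto
  finally have "real d \<le> real k * ?M"
    using assms(2) by (simp add: mult.assoc[symmetric])
  moreover have "0 < k"
    using S \<open>finite S\<close> by (metis card_gt_0_iff order_less_le_trans)
  ultimately show ?thesis
    by (simp add: divide_le_eq mult.commute)
qed

lemma z_coloring_ge_Suc_colors:
  assumes "1 \<le> r" "r \<le> n" "card (colors_of n r c) \<le> r + 1"
  shows "real r / real (r + 1) \<le> z_coloring n r c"
proof (cases "\<exists>s \<in> colors_of n r c. {..<n} \<subseteq> color_span n r c s")
  case True
  then obtain s where s: "s \<in> colors_of n r c" "{..<n} \<subseteq> color_span n r c s"
    by blast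
  have "1 \<le> card {t \<in> {s}. v \<in> color_span n r c t}" if "v < n" for v
  proof -
    have "{t \<in> {s}. v \<in> color_span n r c t} = {s}"
      using s that by auto
    then show ?thesis by simp
  qed
  then have "real 1 / real 1 \<le> z_coloring n r c"
    using assms s by (intro z_coloring_ge_average[of r n "{s}"]) auto
  moreover have "real r / real (r + 1) \<le> 1"
    by (simp add: divide_le_eq)
  ultimately show ?thesis by linarith
next
  case False
  let ?C = "colors_of n r c" and ?V = "color_span n r c"
  note C = colors_of_finite_nonempty[OF assms(2), of c]
  have no_transversal: False
    if f: "\<And>s. s \<in> ?C \<Longrightarrow> f s < n \<and> f s \<notin> ?V s" and small: "card (f ` ?C) \<le> r" for f
  proof -
    obtain s where "s \<in> ?C" "f ` ?C \<subseteq> ?V s"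
      using span_covers[OF assms(2) _ small] f by blast
    with f show False by blast
  qed
  have "\<forall>s\<in>?C. \<exists>v. v < n \<and> v \<notin> ?V s"
    using False by auto
  then obtain f where f: "\<And>s. s \<in> ?C \<Longrightarrow> f s < n \<and> f s \<notin> ?V s"
    unfolding bchoice_iff by blast
  have "\<not> card (f ` ?C) \<le> r"
    using no_transversal f by blast
  then have "card ?C = r + 1"
    using card_image_le[OF C(1), of f] assms(3) by linarith
  have missed_once: "s = t"
    if "v < n" "s \<in> ?C" "t \<in> ?C" "v \<notin> ?V s" "v \<notin> ?V t" for v s t
  proof (rule ccontr)
    assume "s \<noteq> t"
    \<comment> \<open>Reusing \<open>v\<close> for both \<open>s\<close> and \<open>t\<close> saves one vertex, which suffices as \<open>r + 1\<close> colours exceed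
      the allowance by one.\<close>
    let ?g = "f(s := v, t := v)"
    have "?g ` ?C \<subseteq> insert v (f ` (?C - {s, t}))"
      by auto
    then have "card (?g ` ?C) \<le> card (insert v (f ` (?C - {s, t})))"
      using C(1) by (intro card_mono) auto
    also have "\<dots> \<le> Suc (card (f ` (?C - {s, t})))"
      by (rule card_insert_le_m1) auto
    also have "\<dots> \<le> Suc (card (?C - {s, t}))"
      using C(1) by (simp add: card_image_le)
    also have "\<dots> = r"
      using that \<open>s \<noteq> t\<close> \<open>card ?C = r + 1\<close> C(1) assms(1) by (simp add: card_Diff_subset)
    finally have "card (?g ` ?C) \<le> r" .
    moreover have "?g u < n \<and> ?g u \<notin> ?V u" if "u \<in> ?C" for u
      using f[OF that] \<open>v < n\<close> \<open>v \<notin> ?V s\<close> \<open>v \<notin> ?V t\<close> by simp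
    ultimately show False
      using no_transversal by blast
  qed
  have "r \<le> card {s \<in> ?C. v \<in> ?V s}" if "v < n" for v
  proof -
    have "card {s \<in> ?C. v \<notin> ?V s} \<le> Suc 0"
      using missed_once[OF that] C(1) by (subst card_le_Suc0_iff_eq) auto
    moreover have "card ({s \<in> ?C. v \<in> ?V s} \<union> {s \<in> ?C. v \<notin> ?V s}) =
        card {s \<in> ?C. v \<in> ?V s} + card {s \<in> ?C. v \<notin> ?V s}"
      using C(1) by (intro card_Un_disjoint) auto
    moreover have "{s \<in> ?C. v \<in> ?V s} \<union> {s \<in> ?C. v \<notin> ?V s} = ?C"
      by blast
    ultimately show ?thesis
      using \<open>card ?C = r + 1\<close> by simp
  qed
  then show ?thesis
    using assms C(2) by (intro z_coloring_ge_average[of r n ?C]) auto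
qed

lemma z_coloring_ge_six_colors:
  assumes "2 \<le> n" "card (colors_of n 2 c) \<le> 6"
  shows "1 / 2 \<le> z_coloring n 2 c"
proof -
  let ?C = "colors_of n 2 c" and ?V = "color_span n 2 c"
  let ?D = "\<lambda>v. {s \<in> ?C. v \<in> ?V s}"
  note C = colors_of_finite_nonempty[OF assms(1), of c]
  have common: "\<exists>s \<in> ?C. v \<in> ?V s \<and> w \<in> ?V s" if "v < n" "w < n" for v w
  proof -
    have "card {v, w} \<le> 2"
      by (simp add: card_insert_if)
    then obtain s where "s \<in> ?C" "{v, w} \<subseteq> ?V s"
      using span_covers[of 2 n "{v, w}" c] assms(1) \<open>v < n\<close> \<open>w < n\<close> by auto
    then show ?thesis by blast
  qed
  show ?thesis
  proof (cases "\<forall>v<n. 3 \<le> card (?D v)")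
    case True
    then have "real 3 / real 6 \<le> z_coloring n 2 c"
      using assms C(2) by (intro z_coloring_ge_average[of 2 n ?C]) auto
    then show ?thesis by simp
  next
    case False
    then obtain v where v: "v < n" "card (?D v) \<le> 2"
      by (auto simp: not_le)
    \<comment> \<open>Each vertex shares a span with \<open>v\<close>, so the spans containing \<open>v\<close> cover everything.\<close>
    have "1 \<le> card {s \<in> ?D v. w \<in> ?V s}" if "w < n" for w
    proof -
      have "{s \<in> ?D v. w \<in> ?V s} \<noteq> {}"
        using common[OF v(1) that] by blast
      then show ?thesis
        using C(1) by (simp add: Suc_le_eq card_gt_0_iff)
    qed
    moreover have "?D v \<noteq> {}"
      using common[OF v(1) v(1)] by blast
    ultimately have "real 1 / real 2 \<le> z_coloring n 2 c"
      using assms v by (intro z_coloring_ge_average[of 2 n "?D v"]) auto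
    then show ?thesis by simp
  qed
qed

lemma z_min_ge:
  assumes "r \<le> n" "1 \<le> k"
    and "\<And>c. card (colors_of n r c) \<le> k \<Longrightarrow> q \<le> z_coloring n r c"
  shows "q \<le> z_min k n r"
  unfolding z_min_def
  using z_coloring_values_finite_nonempty[OF assms(1,2)] assms(3) by (subst Min_ge_iff) auto

lemma z_inf_ge:
  assumes "1 \<le> k"
    and "\<And>n c. r \<le> n \<Longrightarrow> card (colors_of n r c) \<le> k \<Longrightarrow> q \<le> z_coloring n r c"
  shows "q \<le> z_inf k r"
  unfolding z_inf_def using assms by (intro cINF_greatest z_min_ge) auto

lemma z_coloring_nonneg:
  assumes "r \<le> n"
  shows "0 \<le> z_coloring n r c"
proof -
  have "z_coloring n r c \<in> z_color n r c ` colors_of n r c"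
    unfolding z_coloring_def using colors_of_finite_nonempty[OF assms] by (intro Max_in) auto
  then show ?thesis by (auto simp: z_color_def)
qed

lemma z_inf_le:
  assumes "r \<le> n" "1 \<le> k" "card (colors_of n r c) \<le> k"
  shows "z_inf k r \<le> z_coloring n r c"
proof -
  have "bdd_below ((\<lambda>n. z_min k n r) ` {r..})"
    using assms(2) by (intro bdd_belowI2[of _ 0] z_min_ge z_coloring_nonneg) auto
  then have "z_inf k r \<le> z_min k n r"
    unfolding z_inf_def using assms(1) by (intro cINF_lower) auto
  also have "\<dots> \<le> z_coloring n r c"
    unfolding z_min_def
    using z_coloring_values_finite_nonempty[OF assms(1,2)] assms(3) by (intro Min_le) auto
  finally show ?thesis .
qed

text \<open>
  When all edges of \<open>K\<^sub>n\<^sup>r\<close> have different colours, each span is a single edge and so has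
  exactly \<open>r\<close> vertices.
\<close>

lemma z_inf_le_rainbow:
  assumes "r \<le> n"
  shows "z_inf (n choose r) r \<le> real r / real n"
proof -
  obtain c :: "nat set \<Rightarrow> nat" where c: "inj_on c (complete_edges n r)"
    using finite_imp_inj_to_nat_seg[OF finite_complete_edges] by blast
  have "card (colors_of n r c) = n choose r"
    using card_image[OF c] by (simp add: colors_of_def complete_edges_def)
  then have "z_inf (n choose r) r \<le> z_coloring n r c"
    using assms by (intro z_inf_le) (auto simp: Suc_le_eq)
  also have "\<dots> \<le> real r / real n"
  proof -
    have "z_color n r c s = real r / real n" if "s \<in> colors_of n r c" for s
    proof -
      obtain e where e: "e \<in> complete_edges n r" "s = c e"
        using \<open>s \<in> colors_of n r c\<close> by (auto simp: colors_of_def)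
      then have "color_span n r c s = e"
        using c by (auto simp: color_span_def inj_on_def complete_edges_def nsets_def)
      with e show ?thesis
        by (simp add: z_color_eq complete_edges_def nsets_def)
    qed
    then show ?thesis
      unfolding z_coloring_def
      using colors_of_finite_nonempty[OF assms, of c] by (subst Max_le_iff) auto
  qed
  finally show ?thesis .
qed

lemma z_inf_Suc_colors:
  assumes "1 \<le> r"
  shows "z_inf (r + 1) r = real r / real (r + 1)"
proof (rule antisym)
  show "z_inf (r + 1) r \<le> real r / real (r + 1)"
    using z_inf_le_rainbow[of r "r + 1"] by simp
  show "real r / real (r + 1) \<le> z_inf (r + 1) r"
    using assms by (intro z_inf_ge z_coloring_ge_Suc_colors) auto
qed

lemma z_graph_6: "z_graph 6 = 1 / 2"
proof (rule antisym)
  have six: "(4::nat) choose 2 = 6"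
    by (simp add: choose_two)
  show "z_graph 6 \<le> 1 / 2"
    using z_inf_le_rainbow[of 2 4, unfolded six] by simp
  show "1 / 2 \<le> z_graph 6"
    by (intro z_inf_ge z_coloring_ge_six_colors) auto
qed

theorem corollary2p5:
  "z_graph 3 = 2 / 3
   \<and> (\<forall>r::nat. r \<ge> 2 \<longrightarrow> z_inf (r + 1) r = real r / real (r + 1))
   \<and> z_graph 6 = 1 / 2"
proof (intro conjI allI impI)
  show "z_graph 3 = 2 / 3"
    using z_inf_Suc_colors[of 2] by simp
  show "z_inf (r + 1) r = real r / real (r + 1)" if "r \<ge> 2" for r
    using that by (intro z_inf_Suc_colors) simp
qed (rule z_graph_6)

end
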